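(* Let $(L,A,\cdot,\ell)$ be a left-symmetric Rinehart algebra over a field $\mathbb K$ of characteristic zero and let $(M;\rho,\mu)$ be a representation of it. Then $(L\oplus M,A,\cdot_{L\oplus M},\ell_{L\oplus M})$ is a left-symmetric Rinehart algebra, where for all $x_1,x_2\in L$, $m_1,m_2\in M$, $$(x_1+m_1)\cdot_{L\oplus M}(x_2+m_2)=x_1\cdot x_2+\rho(x_1)m_2+\mu(x_2)m_1,\qquad \ell_{L\oplus M}(x_1+m_1)=\ell(x_1).$$
   Context: All vector spaces are over a field $\mathbb K$ of characteristic zero. A left-symmetric Rinehart algebra is a quadruple $(L,A,\cdot,\ell)$ where $A$ is an associative commutative $\mathbb K$-algebra, $L$ is an $A$-module with a bilinear product satisfying $(x\cdot y)\cdot z-x\cdot(y\cdot z)=(y\cdot x)\cdot z-y\cdot(x\cdot z)$, and $\ell:L\to \mathrm{Der}(A)$ is a linear map such that $\ell(x\cdot y-y\cdot x)=\ell(x)\ell(y)-\ell(y)\ell(x)$, $\ell(ax)=a\ell(x)$, $x\cdot(ay)=\ell(x)(a)\,y+a(x\cdot y)$, and $(ax)\cdot y=a(x\cdot y)$ for all $a\in A$, $x,y,z\in L$. Write $[x,y]=x\cdot y-y\cdot x$. A representation $(M;\rho,\mu)$ of $(L,A,\cdot,\ell)$ consists of an $A$-module $M$, a linear map $\rho:L\to\mathrm{End}_{\mathbb K}(M)$ with $\rho([x,y])=\rho(x)\rho(y)-\rho(y)\rho(x)$, $\rho(ax)m=a\rho(x)m$, $\rho(x)(am)=a\rho(x)m+\ell(x)(a)m$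 (i.e. a representation of the sub-adjacent Lie-Rinehart algebra $(L,A,[\cdot,\cdot],\ell)$), and a linear map $\mu:L\to \mathrm{End}_{\mathbb K}(M)$ with $\mu(ax)m=a\mu(x)m=\mu(x)(am)$ and $\rho(x)\mu(y)-\mu(y)\rho(x)=\mu(x\cdot y)-\mu(y)\mu(x)$, for all $x,y\in L$, $a\in A$, $m\in M$. $L\oplus M$ carries the direct sum $A$-module structure. *)

theory Defs
  imports Complex_Main "HOL-Library.Product_Plus"
begin

definition bilinear_map ::
    "('k::field \<Rightarrow> 'u::ab_group_add \<Rightarrow> 'u) \<Rightarrow> ('k \<Rightarrow> 'v::ab_group_add \<Rightarrow> 'v) \<Rightarrow>
     ('k \<Rightarrow> 'w::ab_group_add \<Rightarrow> 'w) \<Rightarrow> ('u \<Rightarrow> 'v \<Rightarrow> 'w) \<Rightarrow> bool"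
  where "bilinear_map sU sV sW f \<longleftrightarrow>
    (\<forall>u. Vector_Spaces.linear sV sW (f u)) \<and> (\<forall>v. Vector_Spaces.linear sU sW (\<lambda>u. f u v))"

text \<open>Curried, this is also a linear map from \<open>U\<close> to the space of linear maps from \<open>V\<close> to
  \<open>W\<close> with its pointwise operations; the anchor and the maps \<open>\<rho>\<close> and \<open>\<mu>\<close> below are stated this way.\<close>

text \<open>An algebra need not have an identity, so its carrier is only a \<open>comm_ring\<close>.\<close>

locale comm_assoc_algebra = vector_space sA
  for sA :: "'k::field_char_0 \<Rightarrow> 'a::comm_ring \<Rightarrow> 'a" +
  assumes mult_bilinear: "bilinear_map sA sA sA (*)"

text \<open>If the algebra happens to have an identity, modules over it are required to be unital.
  See \<open>algebra_module_iff_module\<close> below for the comparison with \<^locale>\<open>module\<close>.\<close>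

locale algebra_module = comm_assoc_algebra sA + V: vector_space sV
  for sA :: "'k::field_char_0 \<Rightarrow> 'a::comm_ring \<Rightarrow> 'a"
    and sV :: "'k \<Rightarrow> 'v::ab_group_add \<Rightarrow> 'v" +
  fixes act :: "'a \<Rightarrow> 'v \<Rightarrow> 'v"
  assumes act_bilinear: "bilinear_map sA sV sV act"
    and act_mult: "act (a * b) v = act a (act b v)"
    and act_identity: "(\<And>a. e * a = a) \<Longrightarrow> act e v = v"

definition derivation :: "('k::field \<Rightarrow> 'a::comm_ring \<Rightarrow> 'a) \<Rightarrow> ('a \<Rightarrow> 'a) \<Rightarrow> bool"
  where "derivation sA D \<longleftrightarrow>
    Vector_Spaces.linear sA sA D \<and> (\<forall>a b. D (a * b) = D a * b + a * D b)"

locale left_symmetric_Rinehart_algebra = algebra_module sA sL act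
  for sA :: "'k::field_char_0 \<Rightarrow> 'a::comm_ring \<Rightarrow> 'a"
    and sL :: "'k \<Rightarrow> 'l::ab_group_add \<Rightarrow> 'l"
    and act :: "'a \<Rightarrow> 'l \<Rightarrow> 'l" +
  fixes mul :: "'l \<Rightarrow> 'l \<Rightarrow> 'l"
    and anchor :: "'l \<Rightarrow> 'a \<Rightarrow> 'a"
  assumes mul_bilinear: "bilinear_map sL sL sL mul"
    and left_symmetric:
      "mul (mul x y) z - mul x (mul y z) = mul (mul y x) z - mul y (mul x z)"
    and anchor_derivation: "derivation sA (anchor x)"
    and anchor_linear: "bilinear_map sL sA sA anchor"
    and anchor_commutator:
      "anchor (mul x y - mul y x) a = anchor x (anchor y a) - anchor y (anchor x a)"
    and anchor_act: "anchor (act a x) b = a * anchor x b"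
    and mul_act_right: "mul x (act a y) = act (anchor x a) y + act a (mul x y)"
    and mul_act_left: "mul (act a x) y = act a (mul x y)"

locale left_symmetric_Rinehart_representation =
  left_symmetric_Rinehart_algebra sA sL act mul anchor + M: algebra_module sA sM actM
  for sA :: "'k::field_char_0 \<Rightarrow> 'a::comm_ring \<Rightarrow> 'a"
    and sL :: "'k \<Rightarrow> 'l::ab_group_add \<Rightarrow> 'l"
    and act :: "'a \<Rightarrow> 'l \<Rightarrow> 'l"
    and mul :: "'l \<Rightarrow> 'l \<Rightarrow> 'l"
    and anchor :: "'l \<Rightarrow> 'a \<Rightarrow> 'a"
    and sM :: "'k \<Rightarrow> 'm::ab_group_add \<Rightarrow> 'm"
    and actM :: "'a \<Rightarrow> 'm \<Rightarrow> 'm" +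
  fixes \<rho> \<mu> :: "'l \<Rightarrow> 'm \<Rightarrow> 'm"
  assumes rho_linear: "bilinear_map sL sM sM \<rho>"
    and rho_commutator: "\<rho> (mul x y - mul y x) m = \<rho> x (\<rho> y m) - \<rho> y (\<rho> x m)"
    and rho_act_left: "\<rho> (act a x) m = actM a (\<rho> x m)"
    and rho_act_right: "\<rho> x (actM a m) = actM a (\<rho> x m) + actM (anchor x a) m"
    and mu_linear: "bilinear_map sL sM sM \<mu>"
    and mu_act_left: "\<mu> (act a x) m = actM a (\<mu> x m)"
    and mu_act_right: "\<mu> x (actM a m) = actM a (\<mu> x m)"
    and rho_mu: "\<rho> x (\<mu> y m) - \<mu> y (\<rho> x m) = \<mu> (mul x y) m - \<mu> y (\<mu> x m)"

text \<open>The direct sum is the product type with componentwise addition; its scalar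
  multiplication and its \<open>A\<close>-action are both given by the following.\<close>

definition sum_act :: "('r \<Rightarrow> 'l \<Rightarrow> 'l) \<Rightarrow> ('r \<Rightarrow> 'm \<Rightarrow> 'm) \<Rightarrow> 'r \<Rightarrow> 'l \<times> 'm \<Rightarrow> 'l \<times> 'm"
  where "sum_act f g r = (\<lambda>(x, m). (f r x, g r m))"

definition sum_mul ::
    "('l \<Rightarrow> 'l \<Rightarrow> 'l) \<Rightarrow> ('l \<Rightarrow> 'm \<Rightarrow> 'm) \<Rightarrow> ('l \<Rightarrow> 'm \<Rightarrow> 'm) \<Rightarrow>
     'l \<times> 'm::plus \<Rightarrow> 'l \<times> 'm \<Rightarrow> 'l \<times> 'm"
  where "sum_mul mul \<rho> \<mu> = (\<lambda>(x1, m1) (x2, m2). (mul x1 x2, \<rho> x1 m2 + \<mu> x2 m1))"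

definition sum_anchor :: "('l \<Rightarrow> 'a \<Rightarrow> 'a) \<Rightarrow> 'l \<times> 'm \<Rightarrow> 'a \<Rightarrow> 'a"
  where "sum_anchor anchor = (\<lambda>(x, m). anchor x)"

lemma algebra_module_iff_module:
  fixes sA :: "'k::field_char_0 \<Rightarrow> 'a::comm_ring_1 \<Rightarrow> 'a"
    and sV :: "'k \<Rightarrow> 'v::ab_group_add \<Rightarrow> 'v"
  assumes "comm_assoc_algebra sA"
  shows "algebra_module sA sV act \<longleftrightarrow> module act \<and> (\<forall>k v. sV k v = act (sA k 1) v)"
proof
  interpret A: comm_assoc_algebra sA by fact
  have sA_mult: "sA k a * b = sA k (a * b)" "a * sA k b = sA k (a * b)" for k a b
    using A.mult_bilinear
    by (auto simp: bilinear_map_def Vector_Spaces.linear_iff)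
  {
    assume "algebra_module sA sV act"
    then interpret algebra_module sA sV act .
    have id: "act 1 v = v" for v by (rule act_identity) simp
    show "module act \<and> (\<forall>k v. sV k v = act (sA k 1) v)"
      using act_bilinear id
      by (auto simp: bilinear_map_def Vector_Spaces.linear_iff act_mult intro!: module.intro)
  next
    assume *: "module act \<and> (\<forall>k v. sV k v = act (sA k 1) v)"
    then interpret module act by blast
    have sV: "sV k v = act (sA k 1) v" for k v using * by blast
    have vs: "vector_space sV"
      by unfold_locales (simp_all add: sV A.scale_left_distrib scale_left_distrib
        scale_right_distrib sA_mult mult.commute)
    show "algebra_module sA sV act"
    proof (intro algebra_module.intro algebra_module_axioms.intro assms vs)
      show "bilinear_map sA sV sV act"
        by (simp add: bilinear_map_def Vector_Spaces.linear_iff vs A.vector_space_axioms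
          scale_left_distrib scale_right_distrib sV sA_mult)
    next
      fix e v assume "\<And>a::'a. e * a = a"
      then have "e = 1" by (metis mult.right_neutral)
      then show "act e v = v" by simp
    qed simp
  }
qed

end

theory Submission
  imports Defs
begin

lemma vector_space_sum_act:
  assumes "vector_space s" "vector_space t"
  shows "vector_space (sum_act s t)"
proof -
  interpret S: vector_space s by fact
  interpret T: vector_space t by fact
  show ?thesis
    by unfold_locales (auto simp: sum_act_def S.scale_left_distrib S.scale_right_distrib
      T.scale_left_distrib T.scale_right_distrib)
qed

text \<open>Every clause splits into one condition on each factor. In particular, if
  \<open>A\<close> has an identity, it acts trivially on both summands, so the sum is again
  unital.\<close>

lemma algebra_module_sum_act:
  assumes "algebra_module sA sL act" "algebra_module sA sM actM"
  shows "algebra_module sA (sum_act sL sM) (sum_act act actM)"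
proof -
  interpret L: algebra_module sA sL act by fact
  interpret M: algebra_module sA sM actM by fact
  have vs: "vector_space (sum_act sL sM)"
    by (rule vector_space_sum_act) unfold_locales
  show ?thesis
  proof (intro algebra_module.intro algebra_module_axioms.intro L.comm_assoc_algebra_axioms vs)
    show "bilinear_map sA (sum_act sL sM) (sum_act sL sM) (sum_act act actM)"
      using L.act_bilinear M.act_bilinear vs
      by (auto simp: bilinear_map_def Vector_Spaces.linear_iff sum_act_def)
  qed (auto simp: sum_act_def L.act_mult M.act_mult L.act_identity M.act_identity)
qed

context left_symmetric_Rinehart_representation
begin

text \<open>In the \<open>M\<close>-component of the left-symmetry identity, the terms in \<open>m3\<close> cancel because
  \<open>\<rho>\<close> represents the commutator, and those in \<open>m1\<close> and in \<open>m2\<close> by the compatibility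
  of \<open>\<rho>\<close> with \<open>\<mu>\<close>.\<close>

lemma sum_mul_left_symmetric:
  "sum_mul mul \<rho> \<mu> (sum_mul mul \<rho> \<mu> u v) w - sum_mul mul \<rho> \<mu> u (sum_mul mul \<rho> \<mu> v w) =
   sum_mul mul \<rho> \<mu> (sum_mul mul \<rho> \<mu> v u) w - sum_mul mul \<rho> \<mu> v (sum_mul mul \<rho> \<mu> u w)"
proof -
  obtain x1 m1 x2 m2 x3 m3 where [simp]: "u = (x1, m1)" "v = (x2, m2)" "w = (x3, m3)"
    by (metis surj_pair)
  have add: "\<rho> x (m + n) = \<rho> x m + \<rho> x n" "\<mu> x (m + n) = \<mu> x m + \<mu> x n" for x m n
    using rho_linear mu_linear by (auto simp: bilinear_map_def Vector_Spaces.linear_iff)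
  \<comment> \<open>Linearity of \<rho> in its first argument is needed to split
    \<open>\<rho> (mul x y - mul y x)\<close> in \<open>rho_commutator\<close>.\<close>
  have "Vector_Spaces.linear sL sM (\<lambda>x. \<rho> x m)" for m
    using rho_linear by (simp add: bilinear_map_def)
  then have diff: "\<rho> (x - y) m = \<rho> x m - \<rho> y m" for x y m
    by (rule module_hom.diff[OF Vector_Spaces.linear.axioms(3)])
  \<comment> \<open>Kept to this one instance: the right-hand side contains the same term with
    \<open>x1\<close> and \<open>x2\<close> exchanged, so the general equation would rewrite
    forever.\<close>
  have 3: "\<rho> (mul x1 x2) m3 = \<rho> x1 (\<rho> x2 m3) - \<rho> x2 (\<rho> x1 m3) + \<rho> (mul x2 x1) m3"
    using rho_commutator[of x1 x2 m3] by (simp add: diff algebra_simps)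
  \<comment> \<open>Oriented to move every \<mu> to the left of \<rho>; in this normal form the
    terms in \<open>m1\<close> and \<open>m2\<close> agree on both sides.\<close>
  have rho_mu': "\<rho> x (\<mu> y m) = \<mu> y (\<rho> x m) + \<mu> (mul x y) m - \<mu> y (\<mu> x m)" for x y m
    using rho_mu[of x y m] by (simp add: algebra_simps)
  show ?thesis
    using left_symmetric[of x1 x2 x3] by (simp add: sum_mul_def add 3 rho_mu')
qed

end

theorem proposition4p2:
  fixes sA :: "'k::field_char_0 \<Rightarrow> 'a::comm_ring \<Rightarrow> 'a"
    and sL :: "'k \<Rightarrow> 'l::ab_group_add \<Rightarrow> 'l"
    and act :: "'a \<Rightarrow> 'l \<Rightarrow> 'l"
    and mul :: "'l \<Rightarrow> 'l \<Rightarrow> 'l"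
    and anchor :: "'l \<Rightarrow> 'a \<Rightarrow> 'a"
    and sM :: "'k \<Rightarrow> 'm::ab_group_add \<Rightarrow> 'm"
    and actM :: "'a \<Rightarrow> 'm \<Rightarrow> 'm"
    and \<rho> \<mu> :: "'l \<Rightarrow> 'm \<Rightarrow> 'm"
  assumes "left_symmetric_Rinehart_algebra sA sL act mul anchor"
    and "left_symmetric_Rinehart_representation sA sL act mul anchor sM actM \<rho> \<mu>"
  shows "left_symmetric_Rinehart_algebra sA (sum_act sL sM) (sum_act act actM)
    (sum_mul mul \<rho> \<mu>) (sum_anchor anchor)"
proof -
  interpret left_symmetric_Rinehart_representation sA sL act mul anchor sM actM \<rho> \<mu>
    by fact
  have sum: "algebra_module sA (sum_act sL sM) (sum_act act actM)"
    by (rule algebra_module_sum_act) unfold_locales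
  then interpret S: algebra_module sA "sum_act sL sM" "sum_act act actM" .
  have vs: "vector_space (sum_act sL sM)"
    by unfold_locales
  have actM_add: "actM a (m + n) = actM a m + actM a n" for a m n
    using M.act_bilinear by (simp add: bilinear_map_def Vector_Spaces.linear_iff)
  show ?thesis
  proof (intro left_symmetric_Rinehart_algebra.intro left_symmetric_Rinehart_algebra_axioms.intro
      sum sum_mul_left_symmetric)
    show "bilinear_map (sum_act sL sM) (sum_act sL sM) (sum_act sL sM) (sum_mul mul \<rho> \<mu>)"
      using mul_bilinear rho_linear mu_linear vs
      by (auto simp: bilinear_map_def Vector_Spaces.linear_iff sum_act_def sum_mul_def
        M.V.scale_right_distrib algebra_simps)
    show "bilinear_map (sum_act sL sM) sA sA (sum_anchor anchor)"
      using anchor_linear vs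
      by (auto simp: bilinear_map_def Vector_Spaces.linear_iff sum_act_def sum_anchor_def)
  \<comment> \<open>The anchor conditions only see the \<open>L\<close>-component. In the
    \<open>M\<close>-component the roles of the \<mu> rules cross over: scaling the right factor of
    a product scales the argument \<open>x2\<close> of \<mu> and uses \<open>mu_act_left\<close>,
    while scaling the left factor scales \<open>m1\<close> and uses \<open>mu_act_right\<close>. The
    extra anchor term in the first case comes from \<open>rho_act_right\<close>.\<close>
  qed (auto simp: sum_act_def sum_mul_def sum_anchor_def anchor_derivation anchor_commutator
    anchor_act mul_act_right mul_act_left rho_act_left rho_act_right mu_act_left mu_act_right
    actM_add algebra_simps)
qed

end
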